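(* Let $\Delta=\{\delta\in\mathbb{R}^J:\ 0\le\delta_i\le\hat\delta_i\ \forall i\in J\}$ be a box uncertainty set, with $\hat\delta\in\mathbb{R}_+^J$. Let $\mathcal{Q}$ be the convex hull of the incidence vectors of anchored sets. Then $$\mathcal{Q}=\left\{h\in[0,1]^J:\ h_j\le\left\lfloor\frac{M-(L_{sj}+L_{jt})}{L^\Delta_{sj}-L_{sj}}\right\rfloor\ \ \forall j\in J\right\},$$ where, for $j\in J$ with $L^\Delta_{sj}=L_{sj}$, the inequality for $j$ is read as $L_{sj}+(L^\Delta_{sj}-L_{sj})h_j+L_{jt}\le M$.
   Context: Let $J$ be a finite nonempty set of jobs and $\bar J=J\cup\{s,t\}$ with dummy jobs $s,t$ (start and end of the project). Let $G=(\bar J,\mathcal{A})$ be a directed acyclic graph with source $s$ and sink $t$; there is an arc $(s,i)$ (resp. $(i,t)$) for every $i\in J$ without predecessor (resp. successor) in $J$. For $q\in\mathbb{R}_+^J$ (with the convention $q_s=0$), $G(q)$ denotes $G$ with length $q_i$ on every arc $(i,j)\in\mathcal{A}$. A schedule of $G(q)$ is a vector $x\in\mathbb{R}_+^{\bar J}$ with $x_s=0$ and $x_j-x_i\ge q_i$ for every arc $(i,j)\in\mathcal{A}$; its makespan is $x_t$. Write $i\prec j$ if $i\ne j$ and there is a directed path from $i$ to $j$ in $G$, and for $i\prec j$ let $L_{G(q)}(i,j)$ be the length of a longest $i$–$j$ path in $G(q)$. Fix nominal processing times $p\in\mathbb{R}_+^J$ and a deadline $M\ge 0$. For $i\prec j$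 let $L_{ij}=L_{G(p)}(i,j)$ and $L^\Delta_{ij}=\max_{\delta\in\Delta}L_{G(p+\delta)}(i,j)$. Given a schedule $x$ of $G(p)$, a subset $H\subseteq J$ is $x$-anchored if for every $\delta\in\Delta$ there exists a schedule $x^\delta$ of $G(p+\delta)$ such that $x^\delta_i=x_i$ for every $i\in H$. A subset $H\subseteq J$ is anchored if there exists a schedule $x$ of $G(p)$ with $x_t\le M$ such that $H$ is $x$-anchored. *)

theory Defs
  imports
    "HOL-Analysis.Analysis"
    "Graph_Theory.Pair_Digraph"
    "Graph_Theory.Weighted_Graph"
begin

text \<open>The job set \<open>J\<close> is the finite (automatically nonempty) type \<open>'j\<close>, so that vectors indexed by
  \<open>J\<close> are \<open>real ^ 'j\<close>; the set \<open>J \<union> {s, t}\<close> is the type \<open>'j activity\<close>, with \<open>s = Start\<close> and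
  \<open>t = End\<close>.\<close>

datatype 'j activity = Start | Job 'j | End

instance activity :: (finite) finite
proof
  have "UNIV = insert Start (insert End (range (Job :: 'a \<Rightarrow> 'a activity)))"
    by (auto intro: activity.exhaust)
  then show "finite (UNIV :: 'a activity set)"
    by (metis finite finite_imageI finite_insert)
qed

locale project_network = pair_digraph G for G :: "('j :: finite) activity pair_pre_digraph" +
  assumes verts_all: "pverts G = UNIV"
    and no_cycle: "acyclic (parcs G)"
    and start_source: "(u, Start) \<notin> parcs G"
    and end_sink: "(End, v) \<notin> parcs G"
    and arc_from_start: "(\<And>k. (Job k, Job i) \<notin> parcs G) \<Longrightarrow> (Start, Job i) \<in> parcs G"
    and arc_to_end: "(\<And>k. (Job i, Job k) \<notin> parcs G) \<Longrightarrow> (Job i, End) \<in> parcs G"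

text \<open>The length of an arc \<open>(u, v)\<close> of \<open>G(q)\<close> is \<open>q\<^sub>u\<close>, with \<open>q\<^sub>s = 0\<close>. No arc leaves \<open>End\<close>, so the
  value there is immaterial.\<close>

definition duration :: "real ^ 'j \<Rightarrow> ('j :: finite) activity \<Rightarrow> real" where
  "duration q u = (case u of Job i \<Rightarrow> q $ i | _ \<Rightarrow> 0)"

definition is_schedule ::
  "('j :: finite) activity pair_pre_digraph \<Rightarrow> real ^ 'j \<Rightarrow> real ^ 'j activity \<Rightarrow> bool" where
  "is_schedule G q x \<longleftrightarrow>
     (\<forall>u. 0 \<le> x $ u) \<and> x $ Start = 0 \<and> (\<forall>(u, v) \<in> parcs G. x $ v - x $ u \<ge> duration q u)"

text \<open>Only meaningful if \<open>u \<noteq> v\<close> and \<open>v\<close> is reachable from \<open>u\<close>: the maximum then ranges over a finite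
  nonempty set.\<close>

definition longest_path ::
  "('j :: finite) activity pair_pre_digraph \<Rightarrow> real ^ 'j \<Rightarrow> 'j activity \<Rightarrow> 'j activity \<Rightarrow> real" where
  "longest_path G q u v =
     Max {wf_digraph.awalk_cost (\<lambda>e. duration q (fst e)) w |w. pre_digraph.apath (with_proj G) u w v}"

text \<open>For a box \<open>\<Delta>\<close> (more generally, a nonempty compact one) the supremum is attained, i.e. it is the
  maximum over \<open>\<Delta>\<close>.\<close>

definition worst_longest_path ::
  "('j :: finite) activity pair_pre_digraph \<Rightarrow> real ^ 'j \<Rightarrow> (real ^ 'j) set \<Rightarrow>
     'j activity \<Rightarrow> 'j activity \<Rightarrow> real" where
  "worst_longest_path G p \<Delta> u v = (SUP \<delta>\<in>\<Delta>. longest_path G (p + \<delta>) u v)"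

definition schedule_anchored ::
  "('j :: finite) activity pair_pre_digraph \<Rightarrow> real ^ 'j \<Rightarrow> (real ^ 'j) set \<Rightarrow>
     real ^ 'j activity \<Rightarrow> 'j set \<Rightarrow> bool" where
  "schedule_anchored G p \<Delta> x H \<longleftrightarrow>
     (\<forall>\<delta>\<in>\<Delta>. \<exists>y. is_schedule G (p + \<delta>) y \<and> (\<forall>i\<in>H. y $ Job i = x $ Job i))"

definition anchored ::
  "('j :: finite) activity pair_pre_digraph \<Rightarrow> real ^ 'j \<Rightarrow> real \<Rightarrow> (real ^ 'j) set \<Rightarrow>
     'j set \<Rightarrow> bool" where
  "anchored G p M \<Delta> H \<longleftrightarrow>
     (\<exists>x. is_schedule G p x \<and> x $ End \<le> M \<and> schedule_anchored G p \<Delta> x H)"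

definition incidence_vector :: "'j set \<Rightarrow> real ^ ('j :: finite)" where
  "incidence_vector H = (\<chi> j. indicator H j)"

definition anchored_polytope ::
  "('j :: finite) activity pair_pre_digraph \<Rightarrow> real ^ 'j \<Rightarrow> real \<Rightarrow> (real ^ 'j) set \<Rightarrow>
     (real ^ 'j) set" where
  "anchored_polytope G p M \<Delta> = convex hull {incidence_vector H |H. anchored G p M \<Delta> H}"

definition box_uncertainty :: "real ^ 'j \<Rightarrow> (real ^ ('j :: finite)) set" where
  "box_uncertainty \<delta>hat = {\<delta>. \<forall>i. 0 \<le> \<delta> $ i \<and> \<delta> $ i \<le> \<delta>hat $ i}"

end

theory Submission
  imports Defs
begin

text \<open>
  A set \<open>H\<close> can be anchored under box uncertainty exactly if every job can be scheduled nominally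
  within the deadline, \<open>L\<^sub>s\<^sub>j + L\<^sub>j\<^sub>t \<le> M\<close> for all \<open>j\<close>, and every \<open>j \<in> H\<close> can even be started as late as the
  worst case demands, \<open>L\<^sup>\<Delta>\<^sub>s\<^sub>j + L\<^sub>j\<^sub>t \<le> M\<close> (lemma \<open>anchored_box_iff\<close>). Necessity follows from the fact that
  every schedule bounds path lengths. For sufficiency, the componentwise minimum of the worst-case
  earliest schedule and the nominal latest schedule is a schedule of \<open>G(p)\<close> that meets the deadline
  and coincides with the former on \<open>H\<close>. The box shape matters because it has a greatest element: the
  earliest schedule for that element realises \<open>L\<^sup>\<Delta>\<^sub>s\<^sub>j\<close> for all \<open>j\<close> simultaneously and is a schedule under
  every \<open>\<delta>\<close>.

  The condition concerns each element of \<open>H\<close> separately. So the anchored sets are either none at all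
  or precisely the subsets of \<open>K = {j. L\<^sup>\<Delta>\<^sub>s\<^sub>j + L\<^sub>j\<^sub>t \<le> M}\<close>, and the hull of their incidence vectors is empty
  or the face of the unit cube on the coordinates in \<open>K\<close>
  (\<open>convex_hull_incidence_vectors_of_subsets\<close>). The rounded inequalities describe just this set: on
  \<open>[0, 1]\<close>, the one for \<open>j\<close> is infeasible if \<open>L\<^sub>s\<^sub>j + L\<^sub>j\<^sub>t > M\<close>, and otherwise forces \<open>h\<^sub>j = 0\<close> if
  \<open>j \<notin> K\<close> and is void if \<open>j \<in> K\<close> (\<open>floor_constraint_iff\<close>).
\<close>

section \<open>Walks in a project network\<close>

context project_network
begin

lemma walk_vertex_reachable:
  "pcas u w v \<Longrightarrow> set w \<subseteq> parcs G \<Longrightarrow> x \<in> set (pawalk_verts u w) \<Longrightarrow> (u, x) \<in> (parcs G)\<^sup>*"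
proof (induction w arbitrary: u)
  case (Cons e w)
  then show ?case
    by (cases e) (auto intro: converse_rtrancl_into_rtrancl)
qed simp

lemma awalk_iff_cas: "awalk u w v \<longleftrightarrow> set w \<subseteq> parcs G \<and> pcas u w v"
  by (simp add: awalk_def verts_all)

text \<open>In an acyclic graph every walk is a path, so walks may be extended and concatenated
  freely although \<open>longest_path\<close> is a maximum over paths.\<close>

lemma awalk_is_apath: "awalk u w v \<Longrightarrow> apath u w v"
proof (induction w arbitrary: u)
  case Nil
  then show ?case by (simp add: apath_def)
next
  case (Cons e w)
  have arc: "(u, snd e) \<in> parcs G" and rest: "awalk (snd e) w v"
    using Cons.prems by (cases e; auto simp: awalk_iff_cas)+
  have "u \<notin> set (pawalk_verts (snd e) w)"
  proof
    assume "u \<in> set (pawalk_verts (snd e) w)"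
    then have "(snd e, u) \<in> (parcs G)\<^sup>*"
      using rest walk_vertex_reachable by (auto simp: awalk_iff_cas)
    then have "(u, u) \<in> (parcs G)\<^sup>+"
      using arc by (rule rtrancl_into_trancl2[rotated])
    then show False
      using no_cycle by (simp add: acyclic_def)
  qed
  then show ?case
    using Cons.IH[OF rest] Cons.prems by (auto simp: apath_def awalk_iff_cas)
qed

lemma reachable_imp_awalk: "(u, v) \<in> (parcs G)\<^sup>* \<Longrightarrow> \<exists>w. awalk u w v"
proof (induction rule: converse_rtrancl_induct)
  case base
  have "awalk v [] v" by (simp add: awalk_iff_cas)
  then show ?case ..
next
  case (step y z)
  then obtain w where "awalk z w v" by blast
  then have "awalk y ((y, z) # w) v"
    using step.hyps by (simp add: awalk_iff_cas)
  then show ?case ..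
qed

text \<open>Follow predecessors backwards: since the graph is finite and acyclic this ends at a job
  without predecessor job, and such a job has an arc from \<open>Start\<close>. Dually, following successors ends
  at a job with an arc to \<open>End\<close>.\<close>

lemma Start_reaches_Job: "(Start, Job i) \<in> (parcs G)\<^sup>*"
proof -
  have "wf (parcs G)"
    using no_cycle pair_finite_arcs by (simp add: finite_acyclic_wf)
  then have "\<forall>i. v = Job i \<longrightarrow> (Start, v) \<in> (parcs G)\<^sup>*" for v
  proof (induction v rule: wf_induct_rule)
    case (less v)
    then show ?case
      using arc_from_start by (blast intro: rtrancl_into_rtrancl)
  qed
  then show ?thesis by blast
qed

lemma Job_reaches_End: "(Job i, End) \<in> (parcs G)\<^sup>*"
proof -
  have "wf ((parcs G)\<inverse>)"
    using no_cycle pair_finite_arcs by (simp add: finite_acyclic_wf_converse)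
  then have "\<forall>i. v = Job i \<longrightarrow> (v, End) \<in> (parcs G)\<^sup>*" for v
  proof (induction v rule: wf_induct_rule)
    case (less v)
    then show ?case
      using arc_to_end by (blast intro: converse_rtrancl_into_rtrancl)
  qed
  then show ?thesis by blast
qed

text \<open>Types are nonempty, so there is a job to pass through.\<close>

lemma Start_reaches_End: "(Start, End) \<in> (parcs G)\<^sup>*"
  using Start_reaches_Job Job_reaches_End by (rule rtrancl_trans)

lemma ex_awalk_from_Start: "\<exists>w. awalk Start w v"
  using Start_reaches_Job Start_reaches_End
  by (cases v) (auto intro: reachable_imp_awalk)

lemma ex_awalk_to_End: "\<exists>w. awalk v w End"
  using Job_reaches_End Start_reaches_End
  by (cases v) (auto intro: reachable_imp_awalk)


section \<open>Longest paths and schedules\<close>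

abbreviation walk_length :: "real ^ 'j \<Rightarrow> ('j activity \<times> 'j activity) list \<Rightarrow> real" where
  "walk_length q \<equiv> awalk_cost (\<lambda>e. duration q (fst e))"

lemma longest_path_eq_Max: "longest_path G q u v = Max (walk_length q ` {w. apath u w v})"
  by (simp add: longest_path_def setcompr_eq_image)

lemma walk_length_le_longest_path:
  assumes "awalk u w v"
  shows "walk_length q w \<le> longest_path G q u v"
  unfolding longest_path_eq_Max
  using assms by (intro Max_ge finite_imageI apaths_finite) (auto intro: awalk_is_apath)

lemma longest_path_attained:
  assumes "\<exists>w. awalk u w v"
  obtains w where "awalk u w v" "longest_path G q u v = walk_length q w"
proof -
  have "longest_path G q u v \<in> walk_length q ` {w. apath u w v}"
    unfolding longest_path_eq_Max
    using assms by (intro Max_in finite_imageI apaths_finite) (auto intro: awalk_is_apath)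
  then show ?thesis
    using that by (auto simp: apath_def)
qed

lemma longest_path_refl: "longest_path G q v v = 0"
proof -
  have "awalk v [] v" by (simp add: awalk_iff_cas)
  then obtain w where w: "awalk v w v" "longest_path G q v v = walk_length q w"
    using longest_path_attained by blast
  then have "w = []"
    using awalk_is_apath apath_nonempty_ends by blast
  then show ?thesis
    using w by simp
qed

lemma longest_path_nonneg:
  assumes "\<And>j. 0 \<le> q $ j" "\<exists>w. awalk u w v"
  shows "0 \<le> longest_path G q u v"
proof -
  obtain w where w: "longest_path G q u v = walk_length q w"
    using longest_path_attained assms(2) by blast
  have "0 \<le> duration q x" for x
    using assms(1) by (simp add: duration_def split: activity.split)
  then have "0 \<le> walk_length q w"
    unfolding awalk_cost_def by (intro sum_list_nonneg) auto
  then show ?thesis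
    using w by simp
qed

text \<open>The next two inequalities say that \<open>v \<mapsto> longest_path G q Start v\<close> and
  \<open>v \<mapsto> - longest_path G q v End\<close> both satisfy the difference constraints of a schedule.\<close>

lemma longest_path_append_arc:
  assumes "(u, v) \<in> parcs G"
  shows "longest_path G q Start u + duration q u \<le> longest_path G q Start v"
proof -
  obtain w where w: "awalk Start w u" "longest_path G q Start u = walk_length q w"
    using longest_path_attained ex_awalk_from_Start by blast
  have "awalk u [(u, v)] v"
    using assms by (simp add: awalk_iff_cas)
  with w(1) have "awalk Start (w @ [(u, v)]) v" by (rule awalk_appendI)
  then show ?thesis
    using walk_length_le_longest_path[of Start "w @ [(u, v)]" v q] w(2) by simp
qed

lemma longest_path_prepend_arc:
  assumes "(u, v) \<in> parcs G"
  shows "duration q u + longest_path G q v End \<le> longest_path G q u End"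
proof -
  obtain w where w: "awalk v w End" "longest_path G q v End = walk_length q w"
    using longest_path_attained ex_awalk_to_End by blast
  have "awalk u ((u, v) # w) End"
    using assms w(1) by (simp add: awalk_iff_cas)
  then show ?thesis
    using walk_length_le_longest_path[of u "(u, v) # w" End q] w(2) by simp
qed

text \<open>The difference constraints telescope along a walk.\<close>

lemma schedule_walk_length:
  assumes "is_schedule G q x"
  shows "awalk u w v \<Longrightarrow> walk_length q w \<le> x $ v - x $ u"
proof (induction w arbitrary: u)
  case Nil
  then show ?case by (simp add: awalk_iff_cas)
next
  case (Cons e w)
  then have "e \<in> parcs G" "fst e = u" and rest: "awalk (snd e) w v"
    by (auto simp: awalk_iff_cas)
  then have "duration q u \<le> x $ snd e - x $ u"
    using assms by (force simp: is_schedule_def)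
  then show ?case
    using Cons.IH[OF rest] \<open>fst e = u\<close> by simp
qed

lemma schedule_longest_path:
  assumes "is_schedule G q x" "\<exists>w. awalk u w v"
  shows "longest_path G q u v \<le> x $ v - x $ u"
  using longest_path_attained[OF assms(2)] schedule_walk_length[OF assms(1)] by metis

lemma earliest_schedule:
  assumes "\<And>j. 0 \<le> q $ j"
  shows "is_schedule G q (\<chi> v. longest_path G q Start v)"
  using longest_path_nonneg[OF assms ex_awalk_from_Start] longest_path_append_arc
  by (fastforce simp: is_schedule_def longest_path_refl le_diff_eq add.commute)

lemma schedule_antimono:
  assumes "is_schedule G q' x" "\<And>j. q $ j \<le> q' $ j"
  shows "is_schedule G q x"
proof -
  have "duration q u \<le> duration q' u" for u
    using assms(2) by (simp add: duration_def split: activity.split)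
  then show ?thesis
    using assms(1) by (fastforce simp: is_schedule_def intro: order_trans)
qed

text \<open>The earliest schedule for the longer durations is still a schedule for the shorter ones, and
  no schedule starts an activity before the length of a walk leading to it.\<close>

lemma longest_path_from_Start_mono:
  assumes "\<And>j. 0 \<le> q $ j" "\<And>j. q $ j \<le> q' $ j"
  shows "longest_path G q Start v \<le> longest_path G q' Start v"
proof -
  have "is_schedule G q' (\<chi> v. longest_path G q' Start v)"
    using assms order_trans by (blast intro: earliest_schedule)
  then have "is_schedule G q (\<chi> v. longest_path G q' Start v)"
    using assms(2) by (rule schedule_antimono)
  then show ?thesis
    using schedule_longest_path[OF _ ex_awalk_from_Start] by (fastforce simp: longest_path_refl)
qed


section \<open>Anchored sets under box uncertainty\<close>

text \<open>The maximum over the box is attained at its top corner.\<close>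

lemma worst_longest_path_box:
  assumes "\<And>j. 0 \<le> p $ j" "\<And>j. 0 \<le> \<delta>hat $ j"
  shows "worst_longest_path G p (box_uncertainty \<delta>hat) Start v = longest_path G (p + \<delta>hat) Start v"
  unfolding worst_longest_path_def
proof (rule cSup_eq_maximum)
  show "longest_path G (p + \<delta>hat) Start v
      \<in> (\<lambda>\<delta>. longest_path G (p + \<delta>) Start v) ` box_uncertainty \<delta>hat"
    using assms(2) by (auto simp: box_uncertainty_def)
next
  fix l assume "l \<in> (\<lambda>\<delta>. longest_path G (p + \<delta>) Start v) ` box_uncertainty \<delta>hat"
  then obtain \<delta> where \<delta>: "\<delta> \<in> box_uncertainty \<delta>hat" and l: "l = longest_path G (p + \<delta>) Start v"
    by blast
  show "l \<le> longest_path G (p + \<delta>hat) Start v"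
    unfolding l using assms(1) \<delta>
    by (intro longest_path_from_Start_mono) (simp_all add: box_uncertainty_def)
qed

text \<open>The schedule of \<open>G(p)\<close> in which the activities of \<open>H\<close> are anchored combines two start times of
  each activity \<open>v\<close>: the worst-case earliest one, \<open>E v\<close>, which is a schedule of \<open>G(p + \<delta>)\<close> for every
  \<open>\<delta>\<close> in the box, and the nominal latest one, \<open>M - T v\<close>, which respects the deadline. Both satisfy the
  difference constraints of \<open>G(p)\<close>, and difference constraints are preserved by pointwise minima. The
  second condition says that the minimum equals \<open>E\<close> on \<open>H\<close>, so that \<open>E\<close> itself is the schedule
  required for each \<open>\<delta>\<close>; it may overrun the deadline, which binds only the nominal schedule.

  Conversely, for any \<open>j \<in> H\<close> the schedule realising \<open>\<delta>hat\<close> forces the anchored start time of \<open>j\<close> to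
  be at least the worst-case path length, and nominal work remains after \<open>j\<close>.\<close>

lemma anchored_box_iff:
  assumes p: "\<And>j. 0 \<le> p $ j" and \<delta>hat: "\<And>j. 0 \<le> \<delta>hat $ j" and M: "0 \<le> M"
  shows "anchored G p M (box_uncertainty \<delta>hat) H \<longleftrightarrow>
    (\<forall>j. longest_path G p Start (Job j) + longest_path G p (Job j) End \<le> M) \<and>
    (\<forall>j\<in>H. longest_path G (p + \<delta>hat) Start (Job j) + longest_path G p (Job j) End \<le> M)"
    (is "_ \<longleftrightarrow> ?feasible \<and> ?worst")
proof
  assume "anchored G p M (box_uncertainty \<delta>hat) H"
  then obtain x where x: "is_schedule G p x" "x $ End \<le> M"
    and anch: "schedule_anchored G p (box_uncertainty \<delta>hat) x H"
    by (auto simp: anchored_def)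
  have "\<delta>hat \<in> box_uncertainty \<delta>hat"
    using \<delta>hat by (simp add: box_uncertainty_def)
  then obtain y where y: "is_schedule G (p + \<delta>hat) y" "\<forall>i\<in>H. y $ Job i = x $ Job i"
    using anch by (auto simp: schedule_anchored_def)
  have head: "longest_path G q Start v \<le> z $ v" if "is_schedule G q z" for q z v
    using schedule_longest_path[OF that ex_awalk_from_Start, of v] that
    by (simp add: is_schedule_def)
  have tail: "longest_path G p v End \<le> M - x $ v" for v
    using schedule_longest_path[OF x(1) ex_awalk_to_End, of v] x(2) by simp
  have ?feasible
  proof
    fix j
    show "longest_path G p Start (Job j) + longest_path G p (Job j) End \<le> M"
      using head[OF x(1), of "Job j"] tail[of "Job j"] by simp
  qed
  moreover have ?worst
  proof
    fix j assume "j \<in> H"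
    then show "longest_path G (p + \<delta>hat) Start (Job j) + longest_path G p (Job j) End \<le> M"
      using head[OF y(1), of "Job j"] tail[of "Job j"] y(2) by simp
  qed
  ultimately show "?feasible \<and> ?worst" ..
next
  assume A: "?feasible \<and> ?worst"
  define E where "E v = longest_path G (p + \<delta>hat) Start v" for v
  define T where "T v = longest_path G p v End" for v
  \<comment> \<open>An arc leaving \<open>Start\<close> has length zero and only asks for a nonnegative value at its head, so
     \<open>Start\<close> can simply be given the start time \<open>0\<close> that a schedule prescribes.\<close>
  define x :: "real ^ 'j activity"
    where "x = (\<chi> v. if v = Start then 0 else min (E v) (M - T v))"
  have E: "is_schedule G (p + \<delta>hat) (\<chi> v. E v)"
    unfolding E_def using p \<delta>hat by (intro earliest_schedule) simp
  then have E_p: "is_schedule G p (\<chi> v. E v)"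
    using \<delta>hat by (elim schedule_antimono) simp
  have latest_nonneg: "0 \<le> M - T v" if "v \<noteq> Start" for v
  proof (cases v)
    case (Job j)
    have "0 \<le> longest_path G p Start (Job j)"
      using longest_path_nonneg p ex_awalk_from_Start by blast
    then show ?thesis
      using A Job by (fastforce simp: T_def dest: spec[of _ j])
  qed (use that M in \<open>auto simp: T_def longest_path_refl\<close>)
  have x_nonneg: "0 \<le> x $ v" for v
    using E latest_nonneg by (simp add: x_def is_schedule_def)
  have "is_schedule G p x"
    unfolding is_schedule_def
  proof (intro conjI allI ballI)
    fix e assume "e \<in> parcs G"
    then obtain u v where e: "e = (u, v)" and uv: "(u, v) \<in> parcs G"
      by (cases e) auto
    have "v \<noteq> Start"
      using uv start_source by blast
    have "duration p u \<le> x $ v - x $ u"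
    proof (cases "u = Start")
      case True
      then show ?thesis
        using x_nonneg[of v] by (simp add: x_def duration_def)
    next
      case False
      have "E u + duration p u \<le> E v"
        using E_p uv by (fastforce simp: is_schedule_def)
      moreover have "duration p u + T v \<le> T u"
        using longest_path_prepend_arc[OF uv] by (simp add: T_def)
      ultimately show ?thesis
        using False \<open>v \<noteq> Start\<close> by (simp add: x_def min_def)
    qed
    then show "case e of (u, v) \<Rightarrow> duration p u \<le> x $ v - x $ u"
      by (simp add: e)
  qed (use x_nonneg in \<open>simp_all add: x_def\<close>)
  moreover have "x $ End \<le> M"
    by (simp add: x_def T_def longest_path_refl)
  moreover have "schedule_anchored G p (box_uncertainty \<delta>hat) x H"
    unfolding schedule_anchored_def
  proof (intro ballI exI conjI)
    fix \<delta> assume "\<delta> \<in> box_uncertainty \<delta>hat"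
    then show "is_schedule G (p + \<delta>) (\<chi> v. E v)"
      using E by (elim schedule_antimono) (simp add: box_uncertainty_def)
  next
    fix i assume "i \<in> H"
    then have "E (Job i) \<le> M - T (Job i)"
      using A by (fastforce simp: E_def T_def)
    then show "(\<chi> v. E v) $ Job i = x $ Job i"
      by (simp add: x_def)
  qed
  ultimately show "anchored G p M (box_uncertainty \<delta>hat) H"
    by (auto simp: anchored_def)
qed

end


section \<open>The polytope\<close>

text \<open>The coordinate projection \<open>P\<close> onto \<open>K\<close> maps the vertices of the unit cube onto the incidence
  vectors of subsets of \<open>K\<close> and the cube onto its face, and linear maps commute with convex hulls.\<close>

lemma convex_hull_incidence_vectors_of_subsets:
  fixes K :: "'j :: finite set"
  shows "convex hull {incidence_vector H |H. H \<subseteq> K} =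
    {h. (\<forall>j. 0 \<le> h $ j \<and> h $ j \<le> 1) \<and> (\<forall>j. j \<notin> K \<longrightarrow> h $ j = 0)}" (is "_ = ?face")
proof -
  define P :: "real ^ 'j \<Rightarrow> real ^ 'j" where "P h = (\<chi> j. if j \<in> K then h $ j else 0)" for h
  have "linear P"
    by (auto intro!: linearI simp: P_def vec_eq_iff)
  define V :: "(real ^ 'j) set" where "V = {x. \<forall>i. x $ i = 0 \<or> x $ i = 1}"
  have "{incidence_vector H |H. H \<subseteq> K} = P ` V"
  proof (intro equalityI subsetI)
    fix h :: "real ^ 'j" assume "h \<in> {incidence_vector H |H. H \<subseteq> K}"
    then obtain H where H: "h = incidence_vector H" "H \<subseteq> K"
      by blast
    then have "h \<in> V" "P h = h"
      by (auto simp: V_def P_def incidence_vector_def vec_eq_iff indicator_def)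
    then show "h \<in> P ` V"
      by (metis imageI)
  next
    fix h assume "h \<in> P ` V"
    then obtain x where x: "x \<in> V" "h = P x"
      by blast
    then have "h = incidence_vector {j \<in> K. x $ j = 1}"
      by (auto simp: V_def P_def incidence_vector_def vec_eq_iff indicator_def)
    then show "h \<in> {incidence_vector H |H. H \<subseteq> K}"
      by blast
  qed
  then have "convex hull {incidence_vector H |H. H \<subseteq> K} = P ` (convex hull V)"
    using \<open>linear P\<close> by (simp add: convex_hull_linear_image)
  also have "convex hull V = cbox 0 1"
  proof -
    have "V = {x. \<forall>i\<in>Basis. x \<bullet> i = 0 \<or> x \<bullet> i = 1}"
      by (simp add: V_def Basis_vec_def inner_axis)
    then show ?thesis
      by (simp only: unit_interval_convex_hull Cart_1)
  qed
  also have "P ` cbox 0 1 = ?face"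
  proof (intro equalityI subsetI)
    fix h assume "h \<in> ?face"
    then have "h \<in> cbox 0 1" "P h = h"
      by (auto simp: mem_box_cart P_def vec_eq_iff)
    then show "h \<in> P ` cbox 0 1"
      by (metis imageI)
  qed (auto simp: mem_box_cart P_def)
  finally show ?thesis .
qed

text \<open>For \<open>a < b\<close> and \<open>h \<in> [0, 1]\<close> the rounded bound only distinguishes three cases: a negative quotient
  \<open>r = (M - (a + c)) / (b - a)\<close> excludes every \<open>h\<close>, a quotient in \<open>[0, 1)\<close> forces \<open>h = 0\<close>, and a larger
  one imposes nothing.\<close>

lemma floor_constraint_iff:
  fixes a b c h M :: real
  assumes "a \<le> b" "0 \<le> h" "h \<le> 1"
  shows "(if b = a then a + (b - a) * h + c \<le> M else h \<le> of_int \<lfloor>(M - (a + c)) / (b - a)\<rfloor>) \<longleftrightarrow>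
    a + c \<le> M \<and> (h = 0 \<or> b + c \<le> M)"
proof (cases "b = a")
  case False
  define r where "r = (M - (a + c)) / (b - a)"
  have pos: "0 < b - a"
    using assms False by simp
  have "h \<le> of_int \<lfloor>r\<rfloor> \<longleftrightarrow> 0 \<le> r \<and> (h = 0 \<or> 1 \<le> r)"
  proof
    assume h: "h \<le> of_int \<lfloor>r\<rfloor>"
    show "0 \<le> r \<and> (h = 0 \<or> 1 \<le> r)"
    proof (cases "h = 0")
      case True
      then show ?thesis using h by linarith
    next
      case False
      then have "(0::real) < of_int \<lfloor>r\<rfloor>"
        using h assms by linarith
      then have "1 \<le> r" by simp
      then show ?thesis by simp
    qed
  next
    assume "0 \<le> r \<and> (h = 0 \<or> 1 \<le> r)"
    then show "h \<le> of_int \<lfloor>r\<rfloor>"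
      using assms by (auto intro: order_trans[of h 1])
  qed
  moreover have "0 \<le> r \<longleftrightarrow> a + c \<le> M" "1 \<le> r \<longleftrightarrow> b + c \<le> M"
    using pos by (auto simp: r_def zero_le_divide_iff le_divide_eq)
  ultimately show ?thesis
    using False by (simp add: r_def)
qed auto

theorem theorem2:
  fixes G :: "('j :: finite) activity pair_pre_digraph"
    and p \<delta>hat :: "real ^ 'j" and M :: real
  defines "L \<equiv> longest_path G p"
    and "L\<Delta> \<equiv> worst_longest_path G p (box_uncertainty \<delta>hat)"
  assumes "project_network G"
    and "\<And>j. 0 \<le> p $ j"
    and "\<And>j. 0 \<le> \<delta>hat $ j"
    and "0 \<le> M"
  shows "anchored_polytope G p M (box_uncertainty \<delta>hat) =
    {h. (\<forall>j. 0 \<le> h $ j \<and> h $ j \<le> 1) \<and>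
        (\<forall>j. if L\<Delta> Start (Job j) = L Start (Job j)
             then L Start (Job j) + (L\<Delta> Start (Job j) - L Start (Job j)) * h $ j
                    + L (Job j) End \<le> M
             else h $ j \<le> of_int \<lfloor>(M - (L Start (Job j) + L (Job j) End)) /
                                    (L\<Delta> Start (Job j) - L Start (Job j))\<rfloor>)}"
proof -
  interpret project_network G by fact
  define F where "F \<longleftrightarrow> (\<forall>j. L Start (Job j) + L (Job j) End \<le> M)"
  define K where "K = {j. L\<Delta> Start (Job j) + L (Job j) End \<le> M}"
  have L\<Delta>: "L\<Delta> Start v = longest_path G (p + \<delta>hat) Start v" for v
    unfolding L\<Delta>_def using assms by (intro worst_longest_path_box)
  have L_le: "L Start v \<le> L\<Delta> Start v" for v
    unfolding L\<Delta> L_def using assms by (intro longest_path_from_Start_mono) simp_all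
  have anchored_iff: "anchored G p M (box_uncertainty \<delta>hat) H \<longleftrightarrow> F \<and> H \<subseteq> K" for H
    using anchored_box_iff[OF assms(4-6)] unfolding F_def K_def L\<Delta> by (auto simp: L_def)
  have "anchored_polytope G p M (box_uncertainty \<delta>hat) =
      {h. (\<forall>j. 0 \<le> h $ j \<and> h $ j \<le> 1) \<and> F \<and> (\<forall>j. j \<notin> K \<longrightarrow> h $ j = 0)}"
  proof (cases F)
    case True
    then show ?thesis
      by (simp add: anchored_polytope_def anchored_iff convex_hull_incidence_vectors_of_subsets)
  qed (simp add: anchored_polytope_def anchored_iff)
  also have "\<dots> = {h. (\<forall>j. 0 \<le> h $ j \<and> h $ j \<le> 1) \<and>
        (\<forall>j. L Start (Job j) + L (Job j) End \<le> M \<and>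
             (h $ j = 0 \<or> L\<Delta> Start (Job j) + L (Job j) End \<le> M))}"
    by (auto simp: F_def K_def)
  finally show ?thesis
    by (simp add: floor_constraint_iff L_le cong: conj_cong)
qed

end
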